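(* Let $k$ be an algebraically closed field of characteristic $0$, let $n\ge 1$, and let $\mathfrak{n}=\bigoplus_{\alpha\in\Phi^+}(\mathfrak{sl}_{n+1})_\alpha\subseteq\mathfrak{sl}_{n+1}$ be the nilpotent subalgebra spanned by the positive root spaces. For $m\in\mathbb{Z}$ let $\Phi_m\subseteq\Phi^+$ be the set of positive roots $\beta_{i,j}$ with $j-i\ge m$. Then the canonical filtration of the Lie algebra $\mathfrak{n}$ is given by $$F(\mathfrak{n})^{\mathrm{Can}}_m=\bigoplus_{\alpha\in\Phi_m}(\mathfrak{sl}_{n+1})_\alpha .$$
   Context: Use the diagonal Cartan subalgebra of $\mathfrak{sl}_{n+1}=\mathfrak{sl}_{n+1}(k)$ and simple roots $\alpha_i=\bm{e}_i-\bm{e}_{i+1}$ ($1\le i\le n$); the positive roots $\Phi^+$ are $\beta_{i,j}=\sum_{l=i}^{j-1}\alpha_l$ for $1\le i<j\le n+1$, and the root space of $\beta_{i,j}$ is spanned by the matrix unit $E_{i,j}$ (so $\mathfrak{n}$ is the algebra of strictly upper triangular matrices). A filtration $F_\bullet$ of a finite-dimensional Lie algebra $A$ is a family of $k$-subspaces $F_m\subseteq A$, $m\in\mathbb{Z}$, such that $F_i\supseteq F_j$ when $i\le j$; $[F_i,F_j]\subseteq F_{i+j}$ for all $i,j$; $F_i=A$ for $i\ll0$ and $F_i=0$ for $i\gg0$. The trivial filtration has $F_n=A$ for $n\le 0$ and $F_n=0$ for $n>0$. The weights of $F_\bullet$ are the integers $m$ with $F_m\ne F_{m+1}$. Set $$\mathrm{wt}(A,F_\bullet)=\sum_m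 m\dim(F_m/F_{m+1}),\quad \|F_\bullet\|=\Big(\sum_m m^2\dim(F_m/F_{m+1})\Big)^{1/2},\quad \nu(A,F_\bullet)=\frac{-\mathrm{wt}(A,F_\bullet)}{\|F_\bullet\|}$$ ($\nu$ for non-trivial $F_\bullet$). $A$ is semistable if $-\mathrm{wt}(A,F_\bullet)\ge0$ for all filtrations, and unstable otherwise. The canonical filtration $F(A)^{\mathrm{Can}}_\bullet$ is the trivial filtration if $A$ is semistable, and if $A$ is unstable it is the filtration minimizing $\nu(A,-)$, which exists and is unique up to positive rescaling of the weights by a theorem of Kempf. Equalities describing canonical filtrations are understood up to positive rescaling of the weights. *)

theory Defs
  imports Complex_Main "HOL-Library.Function_Algebras" "HOL-Computational_Algebra.Polynomial"
begin

section \<open>Finite-dimensional Lie algebras and their filtrations\<close>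

text \<open>
  The Lie algebra is a subspace \<open>A\<close> of an ambient vector space; the bracket only matters on \<open>A\<close>.
\<close>

locale fd_lie_algebra = vector_space scale
  for scale :: "'k :: field \<Rightarrow> 'v :: ab_group_add \<Rightarrow> 'v" (infixr "*s" 75) +
  fixes bracket :: "'v \<Rightarrow> 'v \<Rightarrow> 'v" and A :: "'v set"
  assumes subspace_A: "subspace A"
    and finite_dim_A: "\<exists>B. finite B \<and> span B = A"
    and bracket_closed: "x \<in> A \<Longrightarrow> y \<in> A \<Longrightarrow> bracket x y \<in> A"
    and bracket_add_left: "x \<in> A \<Longrightarrow> y \<in> A \<Longrightarrow> z \<in> A \<Longrightarrow> bracket (x + y) z = bracket x z + bracket y z"
    and bracket_add_right: "x \<in> A \<Longrightarrow> y \<in> A \<Longrightarrow> z \<in> A \<Longrightarrow> bracket x (y + z) = bracket x y + bracket x z"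
    and bracket_scale_left: "x \<in> A \<Longrightarrow> y \<in> A \<Longrightarrow> bracket (c *s x) y = c *s bracket x y"
    and bracket_scale_right: "x \<in> A \<Longrightarrow> y \<in> A \<Longrightarrow> bracket x (c *s y) = c *s bracket x y"
    and bracket_self: "x \<in> A \<Longrightarrow> bracket x x = 0"
    and jacobi: "x \<in> A \<Longrightarrow> y \<in> A \<Longrightarrow> z \<in> A \<Longrightarrow>
      bracket x (bracket y z) + bracket y (bracket z x) + bracket z (bracket x y) = 0"
begin

text \<open>
  The classes of the elements of \<open>B\<close> are pairwise distinct and form a basis of \<open>V / W\<close>
  (for subspaces \<open>W \<subseteq> V\<close>): every element of \<open>V\<close> is, modulo \<open>W\<close>, a unique
  linear combination of \<open>B\<close>.
\<close>

definition quotient_basis :: "'v set \<Rightarrow> 'v set \<Rightarrow> 'v set \<Rightarrow> bool" where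
  "quotient_basis V W B \<longleftrightarrow> finite B \<and> B \<subseteq> V \<and>
     (\<forall>v\<in>V. \<exists>!c. (\<forall>b. b \<notin> B \<longrightarrow> c b = 0) \<and> v - (\<Sum>b\<in>B. c b *s b) \<in> W)"

definition quotient_dim :: "'v set \<Rightarrow> 'v set \<Rightarrow> nat" where
  "quotient_dim V W = (THE d. \<exists>B. quotient_basis V W B \<and> card B = d)"

lemma quotient_basis_card:
  assumes V: "subspace V" and W: "subspace W" and WV: "W \<subseteq> V"
    and T: "finite T" "V \<subseteq> span T" and B: "quotient_basis V W B"
  shows "card B + dim W = dim V"
proof -
  obtain C where C: "C \<subseteq> W" "independent C" "W \<subseteq> span C" "card C = dim W"
    by (rule basis_exists)
  have finC: "finite C"
    using independent_span_bound[OF T(1) C(2)] C(1) WV T(2) by blast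
  have spanC: "span C = W"
    using C(1,3) W by (simp add: span_minimal subset_antisym)
  have finB: "finite B" and BV: "B \<subseteq> V"
    and ex1: "\<And>v. v \<in> V \<Longrightarrow> \<exists>!c. (\<forall>b. b \<notin> B \<longrightarrow> c b = 0) \<and> v - (\<Sum>b\<in>B. c b *s b) \<in> W"
    using B by (auto simp: quotient_basis_def)
  have zero: "\<forall>b\<in>B. c b = 0" if "(\<Sum>b\<in>B. c b *s b) \<in> W" for c
  proof -
    define c' where "c' = (\<lambda>b. if b \<in> B then c b else 0)"
    have s: "(\<Sum>b\<in>B. c' b *s b) = (\<Sum>b\<in>B. c b *s b)"
      by (rule sum.cong) (auto simp: c'_def)
    define P where "P = (\<lambda>c. (\<forall>b. b \<notin> B \<longrightarrow> c b = 0) \<and> 0 - (\<Sum>b\<in>B. c b *s b) \<in> W)"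
    have "\<exists>!c. P c"
      using ex1[OF subspace_0[OF V]] by (simp only: P_def)
    moreover have "P c'"
      using subspace_neg[OF W that] s by (auto simp: P_def c'_def)
    moreover have "P (\<lambda>_. 0)"
      using subspace_0[OF W] by (simp add: P_def)
    ultimately have "c' = (\<lambda>_. 0)" by blast
    then show ?thesis by (metis c'_def)
  qed
  have disj: "B \<inter> C = {}"
  proof (rule ccontr)
    assume "B \<inter> C \<noteq> {}"
    then obtain b where b: "b \<in> B" "b \<in> W" using C(1) by blast
    have "(\<Sum>x\<in>B. (if x = b then 1 else 0) *s x) = b"
      using finB b(1) by (simp add: if_distrib[where f = "\<lambda>c. c *s _"] cong: if_cong)
    then have "\<forall>x\<in>B. (if x = b then 1 else 0::'k) = 0"
      using zero[of "\<lambda>x. if x = b then 1 else 0"] b(2) by simp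
    then show False using b(1) by auto
  qed
  have ind: "independent (B \<union> C)"
  proof (rule independent_if_scalars_zero)
    show "finite (B \<union> C)" using finB finC by simp
    fix f x
    assume s: "(\<Sum>x\<in>B \<union> C. f x *s x) = 0" and x: "x \<in> B \<union> C"
    have s': "(\<Sum>x\<in>B. f x *s x) + (\<Sum>x\<in>C. f x *s x) = 0"
      using s sum.union_disjoint[OF finB finC disj] by metis
    have "(\<Sum>x\<in>C. f x *s x) \<in> W"
      using C(1) W by (intro subspace_sum subspace_scale) auto
    then have "(\<Sum>x\<in>B. f x *s x) \<in> W"
      using s' subspace_neg[OF W] by (metis add_eq_0_iff2)
    then have fB: "\<forall>x\<in>B. f x = 0" by (rule zero)
    then have "(\<Sum>x\<in>C. f x *s x) = 0" using s' by simp
    then have "\<forall>x\<in>C. f x = 0"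
      using C(2) finC dependent_finite by blast
    with fB x show "f x = 0" by blast
  qed
  have "V \<subseteq> span (B \<union> C)"
  proof
    fix v assume "v \<in> V"
    then obtain c where c: "v - (\<Sum>b\<in>B. c b *s b) \<in> W" using ex1 by blast
    then have "v - (\<Sum>b\<in>B. c b *s b) \<in> span (B \<union> C)"
      using spanC span_mono[of C "B \<union> C"] by auto
    moreover have "(\<Sum>b\<in>B. c b *s b) \<in> span (B \<union> C)"
      by (intro span_sum span_scale span_base) auto
    ultimately show "v \<in> span (B \<union> C)" by (metis diff_add_cancel span_add)
  qed
  moreover have "B \<union> C \<subseteq> V" using BV C(1) WV by blast
  ultimately have "dim V = card (B \<union> C)"
    using ind by (simp add: basis_card_eq_dim)
  then show ?thesis using card_Un_disjoint[OF finB finC disj] C(4) by simp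
qed

lemma quotient_basis_exists:
  assumes V: "subspace V" and W: "subspace W" and WV: "W \<subseteq> V"
    and T: "finite T" "V \<subseteq> span T"
  shows "\<exists>B. quotient_basis V W B"
proof -
  obtain C where C: "C \<subseteq> W" "independent C" "W \<subseteq> span C" "card C = dim W"
    by (rule basis_exists)
  have spanC: "span C = W"
    using C(1,3) W by (simp add: span_minimal subset_antisym)
  obtain D where D: "C \<subseteq> D" "D \<subseteq> V" "independent D" "V \<subseteq> span D"
    using maximal_independent_subset_extend[of C V] order_trans[OF C(1) WV] C(2) by metis
  have finD: "finite D"
    using independent_span_bound[OF T(1) D(3)] D(2) T(2) by blast
  have finC: "finite C" using finD D(1) finite_subset by blast
  define B where "B = D - C"
  have finB: "finite B" using finD by (simp add: B_def)
  have DBC: "D = B \<union> C" "B \<inter> C = {}" using D(1) by (auto simp: B_def)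
  have split: "(\<Sum>x\<in>D. f x *s x) = (\<Sum>x\<in>B. f x *s x) + (\<Sum>x\<in>C. f x *s x)" for f
    using sum.union_disjoint[OF finB finC DBC(2)] DBC(1) by metis
  have inW: "(\<Sum>x\<in>C. f x *s x) \<in> W" for f
    using C(1) W by (intro subspace_sum subspace_scale) auto
  have zero: "\<forall>b\<in>B. c b = 0" if c: "(\<Sum>b\<in>B. c b *s b) \<in> W" for c
  proof -
    obtain e where e: "(\<Sum>b\<in>B. c b *s b) = (\<Sum>x\<in>C. e x *s x)"
      using c unfolding spanC[symmetric] span_finite[OF finC] by auto
    define f where "f = (\<lambda>x. if x \<in> B then c x else - e x)"
    have "(\<Sum>x\<in>B. f x *s x) = (\<Sum>b\<in>B. c b *s b)"
      by (rule sum.cong) (auto simp: f_def)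
    moreover have "(\<Sum>x\<in>C. f x *s x) = - (\<Sum>x\<in>C. e x *s x)"
      unfolding sum_negf[symmetric] using DBC(2) by (intro sum.cong) (auto simp: f_def)
    ultimately have "(\<Sum>x\<in>D. f x *s x) = 0"
      using split[of f] e by simp
    then have "\<forall>x\<in>D. f x = 0" using D(3) finD dependent_finite by blast
    then show ?thesis using DBC(1) by (metis UnI1 f_def)
  qed
  have "quotient_basis V W B"
    unfolding quotient_basis_def
  proof (intro conjI ballI)
    show "finite B" by (rule finB)
    show "B \<subseteq> V" using D(2) by (auto simp: B_def)
    fix v assume "v \<in> V"
    then obtain u where u: "v = (\<Sum>x\<in>D. u x *s x)"
      using D(4) unfolding span_finite[OF finD] by auto
    show "\<exists>!c. (\<forall>b. b \<notin> B \<longrightarrow> c b = 0) \<and> v - (\<Sum>b\<in>B. c b *s b) \<in> W"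
    proof (rule ex_ex1I)
      define c where "c = (\<lambda>b. if b \<in> B then u b else 0)"
      have "(\<Sum>b\<in>B. c b *s b) = (\<Sum>b\<in>B. u b *s b)"
        by (rule sum.cong) (auto simp: c_def)
      then have "v - (\<Sum>b\<in>B. c b *s b) \<in> W" using u split[of u] inW by simp
      then show "\<exists>c. (\<forall>b. b \<notin> B \<longrightarrow> c b = 0) \<and> v - (\<Sum>b\<in>B. c b *s b) \<in> W"
        by (intro exI[of _ c]) (auto simp: c_def)
    next
      fix c c'
      assume c: "(\<forall>b. b \<notin> B \<longrightarrow> c b = 0) \<and> v - (\<Sum>b\<in>B. c b *s b) \<in> W"
        and c': "(\<forall>b. b \<notin> B \<longrightarrow> c' b = 0) \<and> v - (\<Sum>b\<in>B. c' b *s b) \<in> W"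
      have "(v - (\<Sum>b\<in>B. c' b *s b)) - (v - (\<Sum>b\<in>B. c b *s b)) \<in> W"
        using c c' subspace_diff[OF W] by blast
      then have "(\<Sum>b\<in>B. (c b - c' b) *s b) \<in> W"
        by (simp add: scale_left_diff_distrib sum_subtractf)
      then have "\<forall>b\<in>B. c b - c' b = 0" by (rule zero)
      with c c' show "c = c'" by (intro ext) (metis eq_iff_diff_eq_0)
    qed
  qed
  then show ?thesis ..
qed

lemma quotient_dim_eq:
  assumes "subspace V" "subspace W" "W \<subseteq> V" "finite T" "V \<subseteq> span T"
  shows "quotient_dim V W = dim V - dim W"
proof -
  obtain B where B: "quotient_basis V W B" using quotient_basis_exists[OF assms] ..
  have card: "card B' = dim V - dim W" if "quotient_basis V W B'" for B'
    using quotient_basis_card[OF assms that] by simp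
  show ?thesis
    unfolding quotient_dim_def by (rule the_equality) (use B card in auto)
qed

definition filtration :: "(int \<Rightarrow> 'v set) \<Rightarrow> bool" where
  "filtration F \<longleftrightarrow>
     (\<forall>m. subspace (F m) \<and> F m \<subseteq> A) \<and>
     (\<forall>i j. i \<le> j \<longrightarrow> F j \<subseteq> F i) \<and>
     (\<forall>i j. span {bracket x y | x y. x \<in> F i \<and> y \<in> F j} \<subseteq> F (i + j)) \<and>
     eventually (\<lambda>m. F m = A) at_bot \<and>
     eventually (\<lambda>m. F m = {0}) at_top"

definition trivial_filtration :: "int \<Rightarrow> 'v set" where
  "trivial_filtration m = (if m \<le> 0 then A else {0})"

definition weights :: "(int \<Rightarrow> 'v set) \<Rightarrow> int set" where
  "weights F = {m. F m \<noteq> F (m + 1)}"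

text \<open>
  In the sums over all integers, the terms outside the (finite) set of weights vanish.
\<close>

definition wt :: "(int \<Rightarrow> 'v set) \<Rightarrow> int" where
  "wt F = (\<Sum>m\<in>weights F. m * int (quotient_dim (F m) (F (m + 1))))"

definition filtration_norm :: "(int \<Rightarrow> 'v set) \<Rightarrow> real" where
  "filtration_norm F =
     sqrt (real_of_int (\<Sum>m\<in>weights F. m\<^sup>2 * int (quotient_dim (F m) (F (m + 1)))))"

definition nu :: "(int \<Rightarrow> 'v set) \<Rightarrow> real" where
  "nu F = - real_of_int (wt F) / filtration_norm F"

definition semistable :: bool where
  "semistable \<longleftrightarrow> (\<forall>F. filtration F \<longrightarrow> - wt F \<ge> 0)"

text \<open>
  A canonical filtration: one representative of the class, up to positive rescaling, which is
  called the canonical filtration.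
\<close>

definition canonical_filtration :: "(int \<Rightarrow> 'v set) \<Rightarrow> bool" where
  "canonical_filtration F \<longleftrightarrow>
     (if semistable then F = trivial_filtration
      else filtration F \<and> F \<noteq> trivial_filtration \<and>
        (\<forall>G. filtration G \<longrightarrow> G \<noteq> trivial_filtration \<longrightarrow> nu F \<le> nu G))"

end

text \<open>
  Multiplying all weights of \<open>F\<close> by the positive integer \<open>p\<close>: an element of weight \<open>w\<close> lies in
  the \<open>m\<close>-th step of the new filtration iff \<open>p * w \<ge> m\<close>. Since weights are integers, two
  filtrations agree up to a positive rescaling of the weights (by a rational factor \<open>p / q\<close>)
  iff suitable positive integer multiples of them are equal.
\<close>

definition rescale_filtration :: "nat \<Rightarrow> (int \<Rightarrow> 'v set) \<Rightarrow> int \<Rightarrow> 'v set" where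
  "rescale_filtration p F m = F \<lceil>real_of_int m / real p\<rceil>"

definition eq_up_to_rescaling :: "(int \<Rightarrow> 'v set) \<Rightarrow> (int \<Rightarrow> 'v set) \<Rightarrow> bool" where
  "eq_up_to_rescaling F G \<longleftrightarrow>
     (\<exists>p q. p > 0 \<and> q > 0 \<and> rescale_filtration p F = rescale_filtration q G)"


section \<open>The Lie algebra \<open>\<ss>\<ll>\<^sub>N\<close> and its root spaces\<close>

text \<open>
  An \<open>N \<times> N\<close> matrix is a function of two indices that vanishes outside \<open>{1..N} \<times> {1..N}\<close>.
\<close>

type_synonym 'k matrix = "nat \<Rightarrow> nat \<Rightarrow> 'k"

definition mat_scale :: "'k :: field \<Rightarrow> 'k matrix \<Rightarrow> 'k matrix" where
  "mat_scale c X = (\<lambda>i j. c * X i j)"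

definition mat_mult :: "nat \<Rightarrow> 'k :: field matrix \<Rightarrow> 'k matrix \<Rightarrow> 'k matrix" where
  "mat_mult N X Y = (\<lambda>i j. \<Sum>l=1..N. X i l * Y l j)"

definition commutator :: "nat \<Rightarrow> 'k :: field matrix \<Rightarrow> 'k matrix \<Rightarrow> 'k matrix" where
  "commutator N X Y = mat_mult N X Y - mat_mult N Y X"

definition matrix_unit :: "nat \<Rightarrow> nat \<Rightarrow> 'k :: field matrix" where
  "matrix_unit i j = (\<lambda>a b. if a = i \<and> b = j then 1 else 0)"

definition sl :: "nat \<Rightarrow> 'k :: field matrix set" where
  "sl N = {X. (\<forall>i j. X i j \<noteq> 0 \<longrightarrow> i \<in> {1..N} \<and> j \<in> {1..N}) \<and> (\<Sum>i=1..N. X i i) = 0}"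

definition cartan :: "nat \<Rightarrow> 'k :: field matrix set" where
  "cartan N = {H \<in> sl N. \<forall>i j. i \<noteq> j \<longrightarrow> H i j = 0}"

text \<open>
  Roots are integer vectors; the vector \<open>\<alpha>\<close> acts on a diagonal matrix by \<open>H \<mapsto> (\<Sum>l. \<alpha> l * H l l)\<close>.
\<close>

definition unit_vec :: "nat \<Rightarrow> nat \<Rightarrow> int" where
  "unit_vec i = (\<lambda>l. if l = i then 1 else 0)"

definition simple_root :: "nat \<Rightarrow> nat \<Rightarrow> int" where
  "simple_root i = unit_vec i - unit_vec (i + 1)"

definition beta :: "nat \<Rightarrow> nat \<Rightarrow> nat \<Rightarrow> int" where
  "beta i j = (\<Sum>l=i..<j. simple_root l)"

definition root_eval :: "nat \<Rightarrow> (nat \<Rightarrow> int) \<Rightarrow> 'k :: field matrix \<Rightarrow> 'k" where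
  "root_eval N \<alpha> H = (\<Sum>l=1..N. of_int (\<alpha> l) * H l l)"

definition root_space :: "nat \<Rightarrow> (nat \<Rightarrow> int) \<Rightarrow> 'k :: field matrix set" where
  "root_space N \<alpha> =
     {X \<in> sl N. \<forall>H\<in>cartan N. commutator N H X = mat_scale (root_eval N \<alpha> H) X}"

definition positive_roots :: "nat \<Rightarrow> (nat \<Rightarrow> int) set" where
  "positive_roots N = {beta i j | i j. 1 \<le> i \<and> i < j \<and> j \<le> N}"

definition positive_roots_ge :: "nat \<Rightarrow> int \<Rightarrow> (nat \<Rightarrow> int) set" where
  "positive_roots_ge N m = {beta i j | i j. 1 \<le> i \<and> i < j \<and> j \<le> N \<and> int j - int i \<ge> m}"

interpretation mat: vector_space mat_scale
  by unfold_locales (auto simp: mat_scale_def fun_eq_iff algebra_simps)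

text \<open>
  The direct sum of the root spaces indexed by \<open>\<Phi>\<close>, as a subspace of \<open>\<ss>\<ll>\<^sub>N\<close>. (The sum of root
  spaces is automatically direct.)
\<close>

definition root_space_sum :: "nat \<Rightarrow> (nat \<Rightarrow> int) set \<Rightarrow> 'k :: field matrix set" where
  "root_space_sum N \<Phi> = mat.span (\<Union>\<alpha>\<in>\<Phi>. root_space N \<alpha>)"

definition nilradical :: "nat \<Rightarrow> 'k :: field matrix set" where
  "nilradical N = root_space_sum N (positive_roots N)"

definition height_filtration :: "nat \<Rightarrow> int \<Rightarrow> 'k :: field matrix set" where
  "height_filtration N m = root_space_sum N (positive_roots_ge N m)"


subsection \<open>The positive part is a Lie algebra\<close>

lemma beta_eq: "i \<le> j \<Longrightarrow> beta i j = unit_vec i - unit_vec j"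
  unfolding beta_def
proof (induction j rule: dec_induct)
  case (step j)
  then show ?case by (simp add: simple_root_def)
qed simp

lemma root_eval_beta:
  assumes "1 \<le> i" "i < j" "j \<le> N"
  shows "root_eval N (beta i j) H = H i i - H j j"
proof -
  have "root_eval N (beta i j) H = (\<Sum>l=1..N. (if l = i then H l l else 0) - (if l = j then H l l else 0))"
    unfolding root_eval_def using assms
    by (intro sum.cong) (auto simp: beta_eq unit_vec_def)
  also have "\<dots> = H i i - H j j"
    using assms by (simp add: sum_subtractf)
  finally show ?thesis .
qed

lemma commutator_cartan:
  assumes H: "H \<in> cartan N" and X: "X \<in> sl N"
  shows "commutator N H X a b = (H a a - H b b) * X a b"
proof -
  have d: "H i j = 0" if "i \<noteq> j" for i j using H that by (simp add: cartan_def)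
  have s: "X i j = 0" if "\<not> (i \<in> {1..N} \<and> j \<in> {1..N})" for i j
    using X that by (auto simp: sl_def)
  have "(\<Sum>l=1..N. H a l * X l b) = (\<Sum>l=1..N. if l = a then H a a * X a b else 0)"
    by (intro sum.cong) (auto simp: d)
  also have "\<dots> = H a a * X a b" using s[of a b] by auto
  finally have 1: "(\<Sum>l=1..N. H a l * X l b) = H a a * X a b" .
  have "(\<Sum>l=1..N. X a l * H l b) = (\<Sum>l=1..N. if l = b then X a b * H b b else 0)"
    by (intro sum.cong) (auto simp: d)
  also have "\<dots> = X a b * H b b" using s[of a b] by auto
  finally have 2: "(\<Sum>l=1..N. X a l * H l b) = X a b * H b b" .
  show ?thesis
    unfolding commutator_def mat_mult_def fun_diff_def using 1 2 by (simp add: algebra_simps)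
qed

lemma root_space_beta:
  assumes ij: "1 \<le> i" "i < j" "j \<le> N"
  shows "root_space N (beta i j) = mat.span {matrix_unit i j :: 'k :: field_char_0 matrix}"
proof
  show "mat.span {matrix_unit i j :: 'k matrix} \<subseteq> root_space N (beta i j)"
  proof
    fix X :: "'k matrix" assume "X \<in> mat.span {matrix_unit i j}"
    then obtain c where c: "X = mat_scale c (matrix_unit i j)"
      by (auto simp: mat.span_singleton)
    have sl: "X \<in> sl N"
      using ij by (auto simp: sl_def c mat_scale_def matrix_unit_def split: if_splits intro!: sum.neutral)
    show "X \<in> root_space N (beta i j)"
      unfolding root_space_def
    proof (intro CollectI conjI ballI sl ext)
      fix H a b assume "(H :: 'k matrix) \<in> cartan N"
      then show "commutator N H X a b = mat_scale (root_eval N (beta i j) H) X a b"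
        using sl ij
        by (auto simp: commutator_cartan root_eval_beta c mat_scale_def matrix_unit_def)
    qed
  qed
  show "root_space N (beta i j) \<subseteq> mat.span {matrix_unit i j :: 'k matrix}"
  proof
    fix X :: "'k matrix" assume X: "X \<in> root_space N (beta i j)"
    then have sl: "X \<in> sl N" by (simp add: root_space_def)
    have eig: "(H a a - H b b) * X a b = (H i i - H j j) * X a b" if "H \<in> cartan N" for H a b
      using X that commutator_cartan[OF that sl, of a b] root_eval_beta[OF ij, of H]
      by (auto simp: root_space_def mat_scale_def fun_eq_iff)
    have "X a b = 0" if ab: "\<not> (a = i \<and> b = j)" for a b
    proof (rule ccontr)
      assume nz: "X a b \<noteq> 0"
      have abN: "a \<in> {1..N}" "b \<in> {1..N}" using sl nz by (auto simp: sl_def)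
      define h where "h k = (\<lambda>c d. if c = d \<and> c \<in> {1..N}
        then (if c = k then 1 else 0) - 1 / of_nat N else (0 :: 'k))" for k
      have h: "h k \<in> cartan N" if "k \<in> {1..N}" for k
        using that by (auto simp: cartan_def sl_def h_def sum_subtractf split: if_splits)
      have e: "h k a a - h k b b = h k i i - h k j j" if "k \<in> {1..N}" for k
        using eig[OF h[OF that], of a b] nz by simp
      have "a = i"
        using e[of i] abN ij by (auto simp: h_def split: if_splits)
      moreover have "b = j"
        using e[of j] abN ij by (auto simp: h_def split: if_splits)
      ultimately show False using ab by simp
    qed
    then have "X = mat_scale (X i j) (matrix_unit i j)"
      by (auto simp: fun_eq_iff mat_scale_def matrix_unit_def)
    then show "X \<in> mat.span {matrix_unit i j}"
      by (metis mat.span_base mat.span_scale singletonI)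
  qed
qed

lemma sum_matrix_apply: "(\<Sum>x\<in>S. f x :: 'k :: field matrix) a b = (\<Sum>x\<in>S. f x a b)"
  by (induction S rule: infinite_finite_induct) auto

lemma nilradical_eq_span:
  "(nilradical N :: 'k :: field_char_0 matrix set) =
     mat.span ((\<lambda>(i, j). matrix_unit i j) ` {(i, j). 1 \<le> i \<and> i < j \<and> j \<le> N})" (is "?L = ?R")
proof
  have sub: "root_space N \<alpha> \<subseteq> ?R" if "\<alpha> \<in> positive_roots N" for \<alpha>
  proof -
    obtain i j where ij: "1 \<le> i" "i < j" "j \<le> N" "\<alpha> = beta i j"
      using \<open>\<alpha> \<in> positive_roots N\<close> by (auto simp: positive_roots_def)
    show ?thesis
      unfolding ij(4) root_space_beta[OF ij(1-3)] using ij by (intro mat.span_mono) auto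
  qed
  then show "?L \<subseteq> ?R"
    unfolding nilradical_def root_space_sum_def
    by (intro mat.span_minimal) auto
  show "?R \<subseteq> ?L"
    unfolding nilradical_def root_space_sum_def
  proof (rule mat.span_mono, clarify)
    fix i j :: nat assume ij: "1 \<le> i" "i < j" "j \<le> N"
    then have "(matrix_unit i j :: 'k matrix) \<in> root_space N (beta i j)"
      by (simp add: root_space_beta mat.span_base)
    moreover have "beta i j \<in> positive_roots N" using ij by (auto simp: positive_roots_def)
    ultimately show "(matrix_unit i j :: 'k matrix) \<in> (\<Union>\<alpha>\<in>positive_roots N. root_space N \<alpha>)"
      by blast
  qed
qed

lemma finite_upper: "finite {(i :: nat, j :: nat). 1 \<le> i \<and> i < j \<and> j \<le> N}"
  by (rule finite_subset[of _ "{1..N} \<times> {1..N}"]) auto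

lemma nilradical_eq_strictly_upper:
  "(nilradical N :: 'k :: field_char_0 matrix set) =
     {X. \<forall>i j. X i j \<noteq> 0 \<longrightarrow> 1 \<le> i \<and> i < j \<and> j \<le> N}" (is "_ = ?R")
proof
  show "nilradical N \<subseteq> ?R"
    unfolding nilradical_eq_span
  proof (rule mat.span_minimal)
    show "mat.subspace ?R"
      unfolding mat.subspace_def
      by (auto simp: mat_scale_def) (metis add.right_neutral)+
  qed (auto simp: matrix_unit_def split: if_splits)
  show "?R \<subseteq> nilradical N"
  proof
    fix X :: "'k matrix" assume X: "X \<in> ?R"
    let ?I = "{(i :: nat, j :: nat). 1 \<le> i \<and> i < j \<and> j \<le> N}"
    have "X = (\<Sum>p\<in>?I. mat_scale (X (fst p) (snd p)) (matrix_unit (fst p) (snd p)))"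
    proof (intro ext)
      fix a b
      have "(\<Sum>p\<in>?I. mat_scale (X (fst p) (snd p)) (matrix_unit (fst p) (snd p))) a b =
          (\<Sum>p\<in>?I. if p = (a, b) then X a b else 0)"
        unfolding sum_matrix_apply
        by (intro sum.cong) (auto simp: mat_scale_def matrix_unit_def)
      also have "\<dots> = X a b" using X finite_upper[of N] by auto
      finally show "X a b = (\<Sum>p\<in>?I. mat_scale (X (fst p) (snd p)) (matrix_unit (fst p) (snd p))) a b" ..
    qed
    also have "\<dots> \<in> nilradical N"
      unfolding nilradical_eq_span
      by (intro mat.span_sum mat.span_scale mat.span_base) auto
    finally show "X \<in> nilradical N" .
  qed
qed

lemma mat_mult_assoc:
  fixes X Y Z :: "'k :: field matrix"
  shows "mat_mult N (mat_mult N X Y) Z = mat_mult N X (mat_mult N Y Z)"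
proof (intro ext)
  fix i j
  have "(\<Sum>l=1..N. (\<Sum>m=1..N. X i m * Y m l) * Z l j) =
      (\<Sum>l=1..N. \<Sum>m=1..N. X i m * (Y m l * Z l j))"
    by (simp only: sum_distrib_right mult.assoc)
  also have "\<dots> = (\<Sum>m=1..N. \<Sum>l=1..N. X i m * (Y m l * Z l j))"
    by (rule sum.swap)
  also have "\<dots> = (\<Sum>m=1..N. X i m * (\<Sum>l=1..N. Y m l * Z l j))"
    by (simp only: sum_distrib_left)
  finally show "mat_mult N (mat_mult N X Y) Z i j = mat_mult N X (mat_mult N Y Z) i j"
    by (simp only: mat_mult_def)
qed

lemma mat_mult_add_left: "mat_mult N (X + Y) Z = mat_mult N X Z + mat_mult N Y Z"
  and mat_mult_add_right: "mat_mult N Z (X + Y) = mat_mult N Z X + mat_mult N Z Y"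
  and mat_mult_diff_left: "mat_mult N (X - Y) Z = mat_mult N X Z - mat_mult N Y Z"
  and mat_mult_diff_right: "mat_mult N Z (X - Y) = mat_mult N Z X - mat_mult N Z Y"
  by (simp_all add: mat_mult_def fun_eq_iff ring_distribs sum.distrib sum_subtractf)

lemma mat_mult_scale_left: "mat_mult N (mat_scale c X) Z = mat_scale c (mat_mult N X Z)"
  by (simp add: mat_mult_def mat_scale_def fun_eq_iff sum_distrib_left mult.assoc)

lemma mat_mult_scale_right: "mat_mult N Z (mat_scale c X) = mat_scale c (mat_mult N Z X)"
  by (simp add: mat_mult_def mat_scale_def fun_eq_iff sum_distrib_left mult.left_commute)

interpretation nilradical: fd_lie_algebra mat_scale "commutator N"
  "nilradical N :: 'k :: field_char_0 matrix set" for N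
proof
  show "mat.subspace (nilradical N :: 'k matrix set)"
    unfolding nilradical_def root_space_sum_def by (rule mat.subspace_span)
  show "\<exists>B. finite B \<and> mat.span B = (nilradical N :: 'k matrix set)"
    unfolding nilradical_eq_span using finite_upper by blast
  show "commutator N X Y \<in> nilradical N"
    if X: "X \<in> nilradical N" and Y: "Y \<in> nilradical N" for X Y :: "'k matrix"
  proof -
    have mult: "mat_mult N X Y \<in> nilradical N"
      if X: "X \<in> nilradical N" and Y: "Y \<in> nilradical N" for X Y :: "'k matrix"
      unfolding nilradical_eq_strictly_upper
    proof (intro CollectI allI impI)
      fix i j assume "mat_mult N X Y i j \<noteq> 0"
      then obtain l where "X i l * Y l j \<noteq> 0"
        unfolding mat_mult_def by (meson sum.not_neutral_contains_not_neutral)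
      then have "1 \<le> i \<and> i < l \<and> l \<le> N" "1 \<le> l \<and> l < j \<and> j \<le> N"
        using X Y by (auto simp: nilradical_eq_strictly_upper)
      then show "1 \<le> i \<and> i < j \<and> j \<le> N" by simp
    qed
    have "mat.subspace (nilradical N :: 'k matrix set)"
      unfolding nilradical_def root_space_sum_def by (rule mat.subspace_span)
    then show ?thesis
      unfolding commutator_def using mult X Y by (intro mat.subspace_diff) auto
  qed
  fix X Y Z :: "'k matrix" and c :: 'k
  show "commutator N (X + Y) Z = commutator N X Z + commutator N Y Z"
    and "commutator N X (Y + Z) = commutator N X Y + commutator N X Z"
    by (simp_all only: commutator_def mat_mult_add_left mat_mult_add_right add_diff_add)
  show "commutator N (mat_scale c X) Y = mat_scale c (commutator N X Y)"
    and "commutator N X (mat_scale c Y) = mat_scale c (commutator N X Y)"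
    by (simp_all only: commutator_def mat_mult_scale_left mat_mult_scale_right
        mat.scale_right_diff_distrib)
  show "commutator N X X = 0" by (simp only: commutator_def diff_self)
  show "commutator N X (commutator N Y Z) + commutator N Y (commutator N Z X) +
      commutator N Z (commutator N X Y) = 0"
    by (simp add: commutator_def mat_mult_diff_left mat_mult_diff_right mat_mult_assoc)
qed

end

theory Submission
  imports Defs
begin

text \<open>
  The positions \<open>(i, j)\<close> with \<open>1 \<le> i < j \<le> N\<close> index the root spaces of \<open>\<nn>\<close>. Order them by height
  \<open>j - i\<close>, ties being broken compatibly with addition of roots. As for leading terms of
  polynomials, a subspace of \<open>\<nn>\<close> is then measured by the set of its leading positions: their number
  is its dimension (\<open>dim_eq_card_leading_positions\<close>), and the leading position of a bracket is the
  expected one (\<open>leads_at_commutator\<close>). A filtration \<open>F\<close> is thereby degenerated to one that is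
  homogeneous for the torus, and it is recorded by an integer weight \<open>w p\<close> for each position
  \<open>p\<close>. Its total weight is \<open>\<Sum>p. w p\<close>, its squared norm is \<open>\<Sum>p. (w p)\<^sup>2\<close>, and
  \<open>[F\<^sub>a, F\<^sub>b] \<subseteq> F\<^sub>a\<^sub>+\<^sub>b\<close> becomes \<open>w (i, j) + w (j, k) \<le> w (i, k)\<close>. The height filtration has
  the height as its weight.

  Adding these inequalities over all \<open>i < j < k\<close>, each with coefficient one, the weight
  \<open>w (i, j)\<close> occurs with total coefficient \<open>2 (j - i) - N\<close> (\<open>bracket_defect_sum\<close>). Hence
  \<open>N * wt F\<close> is at most twice the inner product of \<open>w\<close> with the height, with equality for the height
  itself. The Cauchy-Schwarz inequality bounds that inner product by the product of the norms, so
  \<open>wt F / \<parallel>F\<parallel>\<close> is largest for the height filtration (\<open>nu_height_filtration_le\<close>).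

  If the maximum is attained, Cauchy-Schwarz is an equality and \<open>w\<close> is a multiple \<open>c\<close> of the height;
  \<open>c\<close> is the weight at \<open>(1, 2)\<close>, hence an integer. Because height comes first in the order, the
  leading positions of \<open>F\<^sub>m\<close> already force \<open>F\<^sub>m\<close> itself to be a step of the height filtration
  (\<open>eq_rescale_height_filtration\<close>).
\<close>

section \<open>Leading positions\<close>

definition upper_positions :: "nat \<Rightarrow> (nat \<times> nat) set" where
  "upper_positions N = {(i, j). 1 \<le> i \<and> i < j \<and> j \<le> N}"

fun height :: "nat \<times> nat \<Rightarrow> int" where
  "height (i, j) = int j - int i"

text \<open>
  Differences of a potential are additive along \<open>(i, j), (j, k) \<mapsto> (i, k)\<close>, which is what makes
  leading positions multiplicative. The linear term dominates, so that height is compared first; the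
  quadratic term separates positions of equal height.
\<close>

definition potential :: "nat \<Rightarrow> nat \<Rightarrow> int" where
  "potential N i = (int N)\<^sup>2 * int i + (int i)\<^sup>2"

fun deg :: "nat \<Rightarrow> nat \<times> nat \<Rightarrow> int" where
  "deg N (i, j) = potential N j - potential N i"

lemma finite_upper_positions [simp]: "finite (upper_positions N)"
  unfolding upper_positions_def by (rule finite_upper)

lemma nilradical_entry:
  "X \<in> nilradical N \<Longrightarrow> X i j \<noteq> (0 :: 'k :: field_char_0) \<Longrightarrow> (i, j) \<in> upper_positions N"
  by (simp add: nilradical_eq_strictly_upper upper_positions_def)

lemma deg_less_if_height_less:
  assumes p: "p \<in> upper_positions N" and q: "q \<in> upper_positions N"
    and less: "height p < height q"
  shows "deg N p < deg N q"
proof -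
  obtain i j where ij: "p = (i, j)" by force
  obtain k l where kl: "q = (k, l)" by force
  have "j \<le> N" "k \<le> l" "0 < i" using p q by (auto simp: upper_positions_def ij kl)
  then have "(int j)\<^sup>2 \<le> (int N)\<^sup>2" "(int k)\<^sup>2 \<le> (int l)\<^sup>2" "0 < (int i)\<^sup>2"
    by (auto intro!: power_mono)
  moreover have "(int N)\<^sup>2 * 1 \<le> (int N)\<^sup>2 * (height q - height p)"
    using less by (intro mult_left_mono) auto
  moreover have "deg N q - deg N p =
      (int N)\<^sup>2 * (height q - height p) + ((int l)\<^sup>2 - (int k)\<^sup>2) - ((int j)\<^sup>2 - (int i)\<^sup>2)"
    by (simp add: ij kl potential_def algebra_simps)
  ultimately show ?thesis by linarith
qed

lemma deg_inj:
  assumes p: "p \<in> upper_positions N" and q: "q \<in> upper_positions N"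
    and eq: "deg N p = deg N q"
  shows "p = q"
proof -
  obtain i j where ij: "p = (i, j)" by force
  obtain k l where kl: "q = (k, l)" by force
  have h: "height p = height q"
    using deg_less_if_height_less[OF p q] deg_less_if_height_less[OF q p] eq by force
  define d where "d = int j - int i"
  have d: "int j = int i + d" "int l = int k + d"
    using h by (auto simp: ij kl d_def)
  have "d > 0" using p by (auto simp: d_def ij upper_positions_def)
  have "2 * d * int i = 2 * d * int k"
    using eq by (simp add: ij kl potential_def d power2_eq_square algebra_simps)
  with \<open>d > 0\<close> have "i = k" by simp
  then show ?thesis using d ij kl by simp
qed

definition leads_at :: "nat \<Rightarrow> 'k :: field matrix \<Rightarrow> nat \<times> nat \<Rightarrow> bool" where
  "leads_at N X p \<longleftrightarrow> p \<in> upper_positions N \<and> X (fst p) (snd p) \<noteq> 0 \<and>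
     (\<forall>i j. X i j \<noteq> 0 \<longrightarrow> deg N p \<le> deg N (i, j))"

definition leading_positions :: "nat \<Rightarrow> 'k :: field matrix set \<Rightarrow> (nat \<times> nat) set" where
  "leading_positions N V = {p. \<exists>X\<in>V. leads_at N X p}"

lemma leading_positions_subset: "leading_positions N V \<subseteq> upper_positions N"
  by (auto simp: leading_positions_def leads_at_def)

lemma finite_leading_positions [simp]: "finite (leading_positions N V)"
  by (rule finite_subset[OF leading_positions_subset]) simp

lemma leading_positions_mono: "U \<subseteq> V \<Longrightarrow> leading_positions N U \<subseteq> leading_positions N V"
  by (auto simp: leading_positions_def)

lemma leads_at_exists:
  assumes X: "X \<in> nilradical N" and nz: "X \<noteq> (0 :: 'k :: field_char_0 matrix)"
  shows "\<exists>p. leads_at N X p"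
proof -
  define S where "S = {p \<in> upper_positions N. X (fst p) (snd p) \<noteq> 0}"
  have fin: "finite S" by (simp add: S_def)
  have inS: "(i, j) \<in> S" if "X i j \<noteq> 0" for i j
    using nilradical_entry[OF X that] that by (simp add: S_def)
  obtain i j where "X i j \<noteq> 0" using nz by (auto simp: fun_eq_iff)
  then have "S \<noteq> {}" using inS by blast
  then have arg: "arg_min_on (deg N) S \<in> S" "\<And>q. q \<in> S \<Longrightarrow> deg N (arg_min_on (deg N) S) \<le> deg N q"
    using fin by (auto intro: arg_min_if_finite arg_min_least)
  then have "leads_at N X (arg_min_on (deg N) S)"
    unfolding leads_at_def using inS by (auto simp: S_def)
  then show ?thesis ..
qed

text \<open>
  Gaussian elimination: if \<open>X\<close> is in \<open>V\<close> but not in \<open>U\<close>, subtracting a multiple of an element of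
  \<open>U\<close> with the same leading position yields another such element whose leading position is strictly
  later, and there are only finitely many positions.
\<close>

lemma subspace_eq_if_leading_positions_eq:
  fixes U V :: "'k :: field_char_0 matrix set"
  assumes U: "mat.subspace U" and V: "mat.subspace V" and UV: "U \<subseteq> V" and VN: "V \<subseteq> nilradical N"
    and L: "leading_positions N V \<subseteq> leading_positions N U"
  shows "U = V"
proof (rule ccontr)
  assume "U \<noteq> V"
  define S where "S = {p. \<exists>X\<in>V - U. leads_at N X p}"
  have lead: "\<exists>p. leads_at N X p" if "X \<in> V - U" for X
    using leads_at_exists[of X N] that VN mat.subspace_0[OF U] by blast
  have fin: "finite S"
    by (rule finite_subset[of _ "upper_positions N"]) (auto simp: S_def leads_at_def)
  have "S \<noteq> {}"
    using \<open>U \<noteq> V\<close> UV lead by (force simp: S_def)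
  then have "Max (deg N ` S) \<in> deg N ` S" using fin by simp
  then obtain p where p: "p \<in> S" "deg N p = Max (deg N ` S)" by force
  have max: "deg N q \<le> deg N p" if "q \<in> S" for q
    using fin that p(2) by simp
  obtain X where X: "X \<in> V" "X \<notin> U" "leads_at N X p" using p(1) by (auto simp: S_def)
  then have "p \<in> leading_positions N U" using L by (auto simp: leading_positions_def)
  then obtain Y where Y: "Y \<in> U" "leads_at N Y p" by (auto simp: leading_positions_def)
  define c where "c = X (fst p) (snd p) / Y (fst p) (snd p)"
  define Z where "Z = X - mat_scale c Y"
  have cY: "mat_scale c Y \<in> U" using mat.subspace_scale[OF U Y(1)] .
  have "Z \<in> V" unfolding Z_def using mat.subspace_diff[OF V X(1)] cY UV by blast
  moreover have "Z \<notin> U"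
  proof
    assume "Z \<in> U"
    then have "Z + mat_scale c Y \<in> U" using mat.subspace_add[OF U] cY by blast
    then show False using X(2) by (simp add: Z_def)
  qed
  ultimately obtain q where q: "leads_at N Z q" and qS: "q \<in> S"
    using lead unfolding S_def by blast
  have Zp: "Z (fst p) (snd p) = 0"
    using Y(2) by (simp add: Z_def c_def mat_scale_def leads_at_def)
  have "Z (fst q) (snd q) \<noteq> 0" using q by (simp add: leads_at_def)
  then have "X (fst q) (snd q) \<noteq> 0 \<or> Y (fst q) (snd q) \<noteq> 0"
    by (auto simp: Z_def mat_scale_def)
  then have "deg N p \<le> deg N (fst q, snd q)" using X(3) Y(2) unfolding leads_at_def by blast
  then have "deg N p = deg N q" using max[OF qS] by simp
  then have "p = q"
    using deg_inj[of p N q] q X(3) by (simp add: leads_at_def)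
  then show False using Zp \<open>Z (fst q) (snd q) \<noteq> 0\<close> by simp
qed

text \<open>
  One element of \<open>V\<close> for each leading position gives a basis: triangularity makes these elements
  independent, and elimination shows that they span.
\<close>

lemma dim_eq_card_leading_positions:
  fixes V :: "'k :: field_char_0 matrix set"
  assumes V: "mat.subspace V" and VN: "V \<subseteq> nilradical N"
  shows "mat.dim V = card (leading_positions N V)"
proof -
  let ?L = "leading_positions N V"
  have "\<forall>p\<in>?L. \<exists>X. X \<in> V \<and> leads_at N X p" by (auto simp: leading_positions_def)
  then obtain b where b: "\<And>p. p \<in> ?L \<Longrightarrow> b p \<in> V \<and> leads_at N (b p) p"
    by (auto dest!: bchoice)
  have pos: "p \<in> upper_positions N" if "p \<in> ?L" for p
    using that leading_positions_subset by blast
  have inj: "inj_on b ?L"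
  proof (rule inj_onI)
    fix p q assume pq: "p \<in> ?L" "q \<in> ?L" "b p = b q"
    have "deg N p \<le> deg N (fst q, snd q)" "deg N q \<le> deg N (fst p, snd p)"
      using b[OF pq(1)] b[OF pq(2)] pq(3) unfolding leads_at_def by metis+
    then show "p = q" by (intro deg_inj[OF pos[OF pq(1)] pos[OF pq(2)]]) simp
  qed
  have ind: "mat.independent (b ` ?L)"
  proof (rule mat.independent_if_scalars_zero)
    show "finite (b ` ?L)" by simp
    fix f x assume s: "(\<Sum>x\<in>b ` ?L. mat_scale (f x) x) = 0" and x: "x \<in> b ` ?L"
    define S where "S = {p \<in> ?L. f (b p) \<noteq> 0}"
    have "S = {}"
    proof (rule ccontr)
      assume ne: "S \<noteq> {}"
      have fin: "finite S" by (simp add: S_def)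
      obtain p where p: "p \<in> S" "\<And>q. q \<in> S \<Longrightarrow> deg N p \<le> deg N q"
        using arg_min_if_finite(1)[OF fin ne, of "deg N"] arg_min_least[OF fin ne, of _ "deg N"] by blast
      \<comment> \<open>At the earliest position \<open>p\<close> with a nonzero coefficient, no other summand contributes.\<close>
      have zero: "f (b q) * b q (fst p) (snd p) = 0" if q: "q \<in> ?L" "q \<noteq> p" for q
      proof (rule ccontr)
        assume nz: "f (b q) * b q (fst p) (snd p) \<noteq> 0"
        then have "deg N q \<le> deg N (fst p, snd p)"
          using b[OF q(1)] unfolding leads_at_def by (metis mult_zero_right)
        moreover have "deg N p \<le> deg N q" using nz q p(2) by (auto simp: S_def)
        moreover have "p \<in> upper_positions N" using p(1) pos by (simp add: S_def)
        ultimately have "q = p" by (intro deg_inj[OF pos[OF q(1)]]) simp_all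
        then show False using q by simp
      qed
      have pL: "p \<in> ?L" using p by (simp add: S_def)
      have "0 = (\<Sum>x\<in>b ` ?L. mat_scale (f x) x) (fst p) (snd p)" using s by simp
      also have "\<dots> = (\<Sum>q\<in>?L. f (b q) * b q (fst p) (snd p))"
        by (simp add: sum_matrix_apply sum.reindex[OF inj] mat_scale_def)
      also have "\<dots> = f (b p) * b p (fst p) (snd p) + (\<Sum>q\<in>?L - {p}. f (b q) * b q (fst p) (snd p))"
        by (rule sum.remove[OF finite_leading_positions pL])
      also have "(\<Sum>q\<in>?L - {p}. f (b q) * b q (fst p) (snd p)) = 0"
        by (rule sum.neutral) (use zero in blast)
      finally show False using p b[OF pL] by (simp add: S_def leads_at_def)
    qed
    then show "f x = 0" using x by (auto simp: S_def)
  qed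
  have sub: "mat.span (b ` ?L) \<subseteq> V"
    using b V by (intro mat.span_minimal) auto
  have "mat.span (b ` ?L) = V"
  proof (rule subspace_eq_if_leading_positions_eq[OF mat.subspace_span V sub VN])
    show "?L \<subseteq> leading_positions N (mat.span (b ` ?L))"
      using b mat.span_base[of _ "b ` ?L"] unfolding leading_positions_def[of N "mat.span _"] by blast
  qed
  then have "mat.dim V = card (b ` ?L)"
    using mat.dim_eq_card[OF _ ind] by (metis mat.span_span)
  then show ?thesis using card_image[OF inj] by simp
qed

lemma mat_mult_entry_deg:
  assumes nz: "mat_mult N X Y a c \<noteq> 0" and X: "leads_at N X p" and Y: "leads_at N Y q"
  shows "deg N p + deg N q \<le> deg N (a, c)"
proof -
  obtain b where "X a b * Y b c \<noteq> 0"
    using nz unfolding mat_mult_def by (meson sum.not_neutral_contains_not_neutral)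
  then have "deg N p \<le> deg N (a, b)" "deg N q \<le> deg N (b, c)"
    using X Y unfolding leads_at_def by auto
  then show ?thesis by simp
qed

text \<open>
  A product \<open>X i l * Y l k\<close> has total degree \<open>deg (i, k) = deg (i, j) + deg (j, k)\<close>, the smallest
  possible, only if both factors sit at their leading positions; since degrees separate positions, this
  leaves \<open>l = j\<close> in \<open>X Y\<close> and nothing in \<open>Y X\<close>.
\<close>

lemma leads_at_commutator:
  fixes X Y :: "'k :: field_char_0 matrix"
  assumes XN: "X \<in> nilradical N" and YN: "Y \<in> nilradical N"
    and X: "leads_at N X (i, j)" and Y: "leads_at N Y (j, k)"
  shows "leads_at N (commutator N X Y) (i, k)"
proof -
  have pos: "(i, j) \<in> upper_positions N" "(j, k) \<in> upper_positions N"
    using X Y by (simp_all add: leads_at_def)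
  then have j: "j \<in> {1..N}" and ik: "(i, k) \<in> upper_positions N" and ij: "i \<noteq> j"
    by (auto simp: upper_positions_def)
  have term0: "X i l * Y l k = 0" if "l \<noteq> j" for l
  proof (rule ccontr)
    assume "X i l * Y l k \<noteq> 0"
    then have nz: "X i l \<noteq> 0" "Y l k \<noteq> 0" by auto
    then have "deg N (i, j) \<le> deg N (i, l)" "deg N (j, k) \<le> deg N (l, k)"
      using X Y unfolding leads_at_def by blast+
    then have "deg N (i, j) = deg N (i, l)" by simp
    then have "(i, j) = (i, l)" using deg_inj[OF pos(1) nilradical_entry[OF XN nz(1)]] by blast
    then show False using that by simp
  qed
  have "mat_mult N X Y i k = X i j * Y j k"
    unfolding mat_mult_def using term0 j
    by (subst sum.remove[of _ j]) (auto intro!: sum.neutral simp del: mult_eq_0_iff)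
  then have XY: "mat_mult N X Y i k \<noteq> 0"
    using X Y by (simp add: leads_at_def)
  have term0': "Y i l * X l k = 0" for l
  proof (rule ccontr)
    assume "Y i l * X l k \<noteq> 0"
    then have nz: "Y i l \<noteq> 0" "X l k \<noteq> 0" by auto
    then have "deg N (j, k) \<le> deg N (i, l)" "deg N (i, j) \<le> deg N (l, k)"
      using X Y unfolding leads_at_def by blast+
    then have "deg N (j, k) = deg N (i, l)" by simp
    then have "(j, k) = (i, l)" using deg_inj[OF pos(2) nilradical_entry[OF YN nz(1)]] by blast
    then show False using ij by simp
  qed
  have YX: "mat_mult N Y X i k = 0"
    unfolding mat_mult_def using term0' by (intro sum.neutral) blast
  have "deg N (i, k) \<le> deg N (a, c)" if "commutator N X Y a c \<noteq> 0" for a c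
  proof -
    have "mat_mult N X Y a c \<noteq> 0 \<or> mat_mult N Y X a c \<noteq> 0"
      using that by (auto simp: commutator_def)
    then have "deg N (i, j) + deg N (j, k) \<le> deg N (a, c)"
      using mat_mult_entry_deg[OF _ X Y] mat_mult_entry_deg[OF _ Y X] by fastforce
    then show ?thesis by simp
  qed
  then show ?thesis
    using ik XY YX by (simp add: leads_at_def commutator_def)
qed

section \<open>Weight functions of filtrations\<close>

text \<open>
  The weight of \<open>p\<close> is the last step of the filtration in which \<open>p\<close> is still a leading position.
\<close>

definition weight_function ::
    "nat \<Rightarrow> (int \<Rightarrow> 'k :: field matrix set) \<Rightarrow> (nat \<times> nat \<Rightarrow> int) \<Rightarrow> bool" where
  "weight_function N F w \<longleftrightarrow>
     (\<forall>p\<in>upper_positions N. \<forall>m. p \<in> leading_positions N (F m) \<longleftrightarrow> m \<le> w p)"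

lemma leading_positions_weight_function:
  "weight_function N F w \<Longrightarrow> leading_positions N (F m) = {p \<in> upper_positions N. m \<le> w p}"
  using leading_positions_subset[of N "F m"] by (auto simp: weight_function_def)

lemma filtrationD:
  fixes F :: "int \<Rightarrow> 'k :: field_char_0 matrix set"
  assumes "nilradical.filtration N F"
  shows "mat.subspace (F m)" "F m \<subseteq> nilradical N" "i \<le> j \<Longrightarrow> F j \<subseteq> F i"
    "X \<in> F i \<Longrightarrow> Y \<in> F j \<Longrightarrow> commutator N X Y \<in> F (i + j)"
    "\<exists>m. F m = nilradical N" "\<exists>m. F m = {0}"
proof -
  note filt = assms[unfolded nilradical.filtration_def]
  note F = filt[THEN conjunct1] filt[THEN conjunct2, THEN conjunct1]
    filt[THEN conjunct2, THEN conjunct2, THEN conjunct1]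
    filt[THEN conjunct2, THEN conjunct2, THEN conjunct2, THEN conjunct1]
    filt[THEN conjunct2, THEN conjunct2, THEN conjunct2, THEN conjunct2]
  show "mat.subspace (F m)" "F m \<subseteq> nilradical N" using F(1) by simp_all
  show "F j \<subseteq> F i" if "i \<le> j" using F(2) that by simp
  show "commutator N X Y \<in> F (i + j)" if "X \<in> F i" "Y \<in> F j"
  proof -
    have "commutator N X Y \<in> {commutator N x y | x y. x \<in> F i \<and> y \<in> F j}" using that by blast
    then show ?thesis by (rule subsetD[OF F(3)[rule_format] mat.span_base])
  qed
  show "\<exists>m. F m = nilradical N" by (rule eventually_happens'[OF _ F(4)]) simp
  show "\<exists>m. F m = {0}" by (rule eventually_happens'[OF _ F(5)]) simp
qed

lemma matrix_unit_in_nilradical: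
  "(i, j) \<in> upper_positions N \<Longrightarrow> (matrix_unit i j :: 'k :: field_char_0 matrix) \<in> nilradical N"
  by (auto simp: nilradical_eq_strictly_upper matrix_unit_def upper_positions_def)

lemma leads_at_matrix_unit:
  "(i, j) \<in> upper_positions N \<Longrightarrow> leads_at N (matrix_unit i j :: 'k :: field matrix) (i, j)"
  by (auto simp: leads_at_def matrix_unit_def)

lemma weight_function_exists:
  fixes F :: "int \<Rightarrow> 'k :: field_char_0 matrix set"
  assumes F: "nilradical.filtration N F"
  shows "\<exists>w. weight_function N F w"
proof -
  have "\<exists>w. \<forall>m. p \<in> leading_positions N (F m) \<longleftrightarrow> m \<le> w" if p: "p \<in> upper_positions N" for p
  proof -
    obtain a where a: "F a = nilradical N" using filtrationD(5)[OF F] by blast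
    obtain b where b: "F b = {0}" using filtrationD(6)[OF F] by blast
    have anti: "p \<in> leading_positions N (F i)" if "p \<in> leading_positions N (F j)" "i \<le> j" for i j
      using leading_positions_mono[OF filtrationD(3)[OF F that(2)]] that(1) by blast
    obtain i j where ij: "p = (i, j)" by force
    have pa: "p \<in> leading_positions N (F a)"
      unfolding a leading_positions_def
      using matrix_unit_in_nilradical[of i j N] leads_at_matrix_unit[of i j N] p ij by blast
    have pb: "p \<notin> leading_positions N (F b)"
      by (simp add: b leading_positions_def leads_at_def)
    define S where "S = {m \<in> {a..b}. p \<in> leading_positions N (F m)}"
    have fin: "finite S" by (rule finite_subset[of _ "{a..b}"]) (auto simp: S_def)
    have "a \<le> b" using anti[OF pa, of b] pb by linarith
    then have "S \<noteq> {}" using pa by (auto simp: S_def)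
    then have "Max S \<in> S" using fin by simp
    have "p \<in> leading_positions N (F m) \<longleftrightarrow> m \<le> Max S" for m
    proof
      assume m: "p \<in> leading_positions N (F m)"
      have "m \<le> b" using anti[OF m, of b] pb by linarith
      show "m \<le> Max S"
      proof (cases "a \<le> m")
        case True
        then have "m \<in> S" using m \<open>m \<le> b\<close> by (simp add: S_def)
        then show ?thesis using fin by simp
      next
        case False
        then show ?thesis using \<open>Max S \<in> S\<close> by (auto simp: S_def)
      qed
    next
      assume "m \<le> Max S"
      moreover have "p \<in> leading_positions N (F (Max S))"
        using \<open>Max S \<in> S\<close> unfolding S_def by blast
      ultimately show "p \<in> leading_positions N (F m)" using anti by blast
    qed
    then show ?thesis by blast
  qed
  then show ?thesis unfolding weight_function_def by (intro bchoice ballI)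
qed

lemma weight_function_superadditive:
  fixes F :: "int \<Rightarrow> 'k :: field_char_0 matrix set"
  assumes F: "nilradical.filtration N F" and w: "weight_function N F w"
    and pos: "(i, j) \<in> upper_positions N" "(j, k) \<in> upper_positions N"
  shows "w (i, j) + w (j, k) \<le> w (i, k)"
proof -
  have "(i, j) \<in> leading_positions N (F (w (i, j)))" "(j, k) \<in> leading_positions N (F (w (j, k)))"
    using w pos by (simp_all add: weight_function_def)
  then obtain X Y where X: "X \<in> F (w (i, j))" "leads_at N X (i, j)"
    and Y: "Y \<in> F (w (j, k))" "leads_at N Y (j, k)"
    by (auto simp: leading_positions_def)
  have "leads_at N (commutator N X Y) (i, k)"
    using leads_at_commutator X Y filtrationD(2)[OF F] by blast
  then have "(i, k) \<in> leading_positions N (F (w (i, j) + w (j, k)))"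
    using filtrationD(4)[OF F X(1) Y(1)] by (auto simp: leading_positions_def)
  moreover have "(i, k) \<in> upper_positions N"
    using pos by (auto simp: upper_positions_def)
  ultimately show ?thesis using w by (simp add: weight_function_def)
qed

text \<open>
  Passing from \<open>F m\<close> to \<open>F (m + 1)\<close> loses exactly the leading positions of weight \<open>m\<close>.
\<close>

lemma filtration_step_quotient_dim:
  fixes F :: "int \<Rightarrow> 'k :: field_char_0 matrix set"
  assumes F: "nilradical.filtration N F" and w: "weight_function N F w"
  shows "nilradical.quotient_dim (F m) (F (m + 1)) = card {p \<in> upper_positions N. w p = m}"
proof -
  obtain T where T: "finite T" "mat.span T = (nilradical N :: 'k matrix set)"
    using nilradical.finite_dim_A by blast
  let ?P = "\<lambda>m. {p \<in> upper_positions N. m \<le> w p}"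
  have "nilradical.quotient_dim (F m) (F (m + 1)) = mat.dim (F m) - mat.dim (F (m + 1))"
    using filtrationD(2)[OF F, of m] T
    by (intro nilradical.quotient_dim_eq filtrationD[OF F]) auto
  also have "\<dots> = card (?P m) - card (?P (m + 1))"
    using leading_positions_weight_function[OF w]
    by (simp add: dim_eq_card_leading_positions[OF filtrationD(1,2)[OF F]])
  also have "\<dots> = card (?P m - ?P (m + 1))"
    by (rule card_Diff_subset[symmetric]) auto
  also have "?P m - ?P (m + 1) = {p \<in> upper_positions N. w p = m}" by auto
  finally show ?thesis .
qed

lemma weights_eq_image:
  fixes F :: "int \<Rightarrow> 'k :: field_char_0 matrix set"
  assumes F: "nilradical.filtration N F" and w: "weight_function N F w"
  shows "nilradical.weights F = w ` upper_positions N"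
proof -
  have "F m = F (m + 1) \<longleftrightarrow> leading_positions N (F m) = leading_positions N (F (m + 1))" for m
    using subspace_eq_if_leading_positions_eq[of "F (m + 1)" "F m" N] filtrationD[OF F] by auto
  also have "\<dots> m \<longleftrightarrow> m \<notin> w ` upper_positions N" for m
  proof -
    have "m + 1 \<le> w p \<longleftrightarrow> m \<le> w p \<and> w p \<noteq> m" for p by auto
    then show ?thesis unfolding leading_positions_weight_function[OF w] by blast
  qed
  finally show ?thesis by (auto simp: nilradical.weights_def)
qed

text \<open>
  With \<open>g m = m\<close> and \<open>g m = m\<^sup>2\<close> this gives the total weight and the squared norm.
\<close>

lemma sum_over_weights:
  fixes F :: "int \<Rightarrow> 'k :: field_char_0 matrix set"
  assumes F: "nilradical.filtration N F" and w: "weight_function N F w"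
  shows "(\<Sum>m\<in>nilradical.weights F. g m * int (nilradical.quotient_dim (F m) (F (m + 1)))) =
    (\<Sum>p\<in>upper_positions N. g (w p))"
proof -
  have "(\<Sum>p\<in>upper_positions N. g (w p)) =
      (\<Sum>m\<in>w ` upper_positions N. \<Sum>p\<in>{p \<in> upper_positions N. w p = m}. g (w p))"
    by (rule sum.image_gen) simp
  also have "\<dots> = (\<Sum>m\<in>w ` upper_positions N. g m * int (card {p \<in> upper_positions N. w p = m}))"
    by (intro sum.cong) (simp_all add: mult.commute)
  finally show ?thesis
    unfolding weights_eq_image[OF F w] filtration_step_quotient_dim[OF F w] by simp
qed

section \<open>The height filtration\<close>

text \<open>
  A direct sum of root spaces is cut out by the vanishing of the other matrix entries; in this form
  the bracket and the leading positions can be read off.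
\<close>

lemma height_filtration_eq:
  "(height_filtration N m :: 'k :: field_char_0 matrix set) =
     {X \<in> nilradical N. \<forall>i j. X i j \<noteq> 0 \<longrightarrow> m \<le> height (i, j)}" (is "?L = ?R")
proof
  have sub: "mat.subspace ?R"
    using nilradical.subspace_A[of N]
    unfolding mat.subspace_def by (auto simp: mat_scale_def) (metis add.right_neutral)
  have "root_space N \<alpha> \<subseteq> ?R" if "\<alpha> \<in> positive_roots_ge N m" for \<alpha>
  proof -
    obtain i j where ij: "1 \<le> i" "i < j" "j \<le> N" "\<alpha> = beta i j" "m \<le> height (i, j)"
      using \<open>\<alpha> \<in> positive_roots_ge N m\<close> by (auto simp: positive_roots_ge_def)
    have "(matrix_unit i j :: 'k matrix) \<in> ?R"
      using ij matrix_unit_in_nilradical[of i j N, where 'k = 'k]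
      by (auto simp: upper_positions_def matrix_unit_def)
    then show ?thesis
      unfolding ij(4) root_space_beta[OF ij(1-3)] using sub by (intro mat.span_minimal) auto
  qed
  then show "?L \<subseteq> ?R"
    unfolding height_filtration_def root_space_sum_def
    using sub by (intro mat.span_minimal) auto
  show "?R \<subseteq> ?L"
  proof
    fix X :: "'k matrix" assume X: "X \<in> ?R"
    let ?E = "\<lambda>p. mat_scale (X (fst p) (snd p)) (matrix_unit (fst p) (snd p))"
    have "X = (\<Sum>p\<in>upper_positions N. ?E p)"
    proof (intro ext)
      fix a b
      have "(\<Sum>p\<in>upper_positions N. ?E p) a b =
          (\<Sum>p\<in>upper_positions N. if p = (a, b) then X a b else 0)"
        unfolding sum_matrix_apply
        by (intro sum.cong) (auto simp: mat_scale_def matrix_unit_def)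
      also have "\<dots> = X a b" using X nilradical_entry[of X N a b] by auto
      finally show "X a b = (\<Sum>p\<in>upper_positions N. ?E p) a b" ..
    qed
    also have "\<dots> \<in> ?L"
      unfolding height_filtration_def root_space_sum_def
    proof (rule mat.span_sum)
      fix p assume p: "p \<in> upper_positions N"
      obtain i j where ij: "p = (i, j)" by force
      show "?E p \<in> mat.span (\<Union>\<alpha>\<in>positive_roots_ge N m. root_space N \<alpha>)"
      proof (cases "X i j = 0")
        case True
        then have "?E p = 0" by (simp add: ij mat_scale_def fun_eq_iff)
        then show ?thesis using mat.span_zero by metis
      next
        case False
        then have "m \<le> height (i, j)" using X by blast
        then have "beta i j \<in> positive_roots_ge N m"
          using p by (auto simp: ij upper_positions_def positive_roots_ge_def)
        moreover have "(matrix_unit i j :: 'k matrix) \<in> root_space N (beta i j)"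
          using p root_space_beta[of i j N, where 'k = 'k]
          by (simp add: ij upper_positions_def mat.span_base)
        ultimately show ?thesis
          unfolding ij fst_conv snd_conv by (intro mat.span_scale mat.span_base) blast
      qed
    qed
    finally show "X \<in> ?L" .
  qed
qed

lemma height_bounds: "p \<in> upper_positions N \<Longrightarrow> 1 \<le> height p \<and> height p < int N"
  by (auto simp: upper_positions_def)

lemma filtration_height_filtration:
  "nilradical.filtration N (height_filtration N :: int \<Rightarrow> 'k :: field_char_0 matrix set)"
  (is "nilradical.filtration N ?H")
  unfolding nilradical.filtration_def
proof (intro conjI allI impI)
  show sub: "mat.subspace (?H m)" for m
    unfolding height_filtration_def root_space_sum_def by (rule mat.subspace_span)
  show "?H m \<subseteq> nilradical N" for m by (auto simp: height_filtration_eq)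
  show "?H j \<subseteq> ?H i" if "i \<le> j" for i j
    using that by (fastforce simp: height_filtration_eq)
  have mult: "i + j \<le> height (a, c)"
    if X: "X \<in> ?H i" and Y: "Y \<in> ?H j" and nz: "mat_mult N X Y a c \<noteq> 0" for i j X Y a c
  proof -
    obtain b where "X a b * Y b c \<noteq> 0"
      using nz unfolding mat_mult_def by (meson sum.not_neutral_contains_not_neutral)
    then have "i \<le> height (a, b)" "j \<le> height (b, c)"
      using X Y unfolding height_filtration_eq by auto
    then show ?thesis by simp
  qed
  show "mat.span {commutator N X Y | X Y. X \<in> ?H i \<and> Y \<in> ?H j} \<subseteq> ?H (i + j)" for i j
  proof (rule mat.span_minimal[OF _ sub], clarify)
    fix X Y assume X: "X \<in> ?H i" and Y: "Y \<in> ?H j"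
    have "i + j \<le> height (a, c)" if "commutator N X Y a c \<noteq> 0" for a c
    proof -
      have "mat_mult N X Y a c \<noteq> 0 \<or> mat_mult N Y X a c \<noteq> 0"
        using that by (auto simp: commutator_def)
      then show ?thesis using mult[OF X Y] mult[OF Y X] by (auto simp: add.commute)
    qed
    moreover have "commutator N X Y \<in> nilradical N"
      using X Y by (intro nilradical.bracket_closed) (auto simp: height_filtration_eq)
    ultimately show "commutator N X Y \<in> ?H (i + j)"
      by (simp add: height_filtration_eq)
  qed
  have low: "?H m = nilradical N" if "m \<le> 1" for m
    using that height_bounds nilradical_entry by (fastforce simp: height_filtration_eq)
  show "eventually (\<lambda>m. ?H m = nilradical N) at_bot"
    unfolding eventually_at_bot_linorder using low by blast
  have high: "?H m = {0}" if "m \<ge> int N" for m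
  proof -
    have "X = 0" if X: "X \<in> ?H m" for X
    proof (intro ext)
      fix i j show "X i j = (0 :: 'k matrix) i j"
        using X \<open>m \<ge> int N\<close> height_bounds[of "(i, j)" N] nilradical_entry[of X N i j]
        by (force simp: height_filtration_eq)
    qed
    then show ?thesis using mat.subspace_0[OF sub] by blast
  qed
  show "eventually (\<lambda>m. ?H m = {0}) at_top"
    unfolding eventually_at_top_linorder using high by blast
qed

lemma weight_function_height_filtration:
  "weight_function N (height_filtration N :: int \<Rightarrow> 'k :: field_char_0 matrix set) height"
  unfolding weight_function_def
proof (intro ballI allI)
  fix p m assume p: "p \<in> upper_positions N"
  obtain i j where ij: "p = (i, j)" by force
  show "p \<in> leading_positions N (height_filtration N m :: 'k matrix set) \<longleftrightarrow> m \<le> height p"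
  proof
    assume "p \<in> leading_positions N (height_filtration N m :: 'k matrix set)"
    then show "m \<le> height p"
      by (auto simp: leading_positions_def leads_at_def height_filtration_eq ij)
  next
    assume "m \<le> height p"
    then have "(matrix_unit i j :: 'k matrix) \<in> height_filtration N m"
      using p matrix_unit_in_nilradical[of i j N, where 'k = 'k] ij
      by (auto simp: height_filtration_eq matrix_unit_def)
    then show "p \<in> leading_positions N (height_filtration N m :: 'k matrix set)"
      unfolding leading_positions_def
      using leads_at_matrix_unit[of i j N] p ij by blast
  qed
qed

section \<open>The optimality inequality\<close>

lemma sum_upper_positions:
  "(\<Sum>p\<in>upper_positions N. g p) = (\<Sum>i=1..N. \<Sum>j=1..N. if i < j then g (i, j) else (0 :: int))"
proof -
  have "upper_positions N = {p \<in> {1..N} \<times> {1..N}. fst p < snd p}"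
    by (auto simp: upper_positions_def)
  then have "(\<Sum>p\<in>upper_positions N. g p) =
      (\<Sum>p\<in>{1..N} \<times> {1..N}. if fst p < snd p then g p else 0)"
    by (simp only: sum.inter_filter finite_cartesian_product finite_atLeastAtMost)
  also have "\<dots> = (\<Sum>p\<in>{1..N} \<times> {1..N}. case p of (i, j) \<Rightarrow> if i < j then g (i, j) else 0)"
    by (rule sum.cong) auto
  finally show ?thesis by (simp only: sum.cartesian_product)
qed

text \<open>
  In the sum over all triples \<open>i < j < k\<close>, a fixed pair \<open>(a, b)\<close> occurs positively once for each index
  strictly between \<open>a\<close> and \<open>b\<close>, and negatively once for each index in \<open>{1..N}\<close> below \<open>a\<close> or above
  \<open>b\<close>: in total \<open>(b - a - 1) - (N - b) - (a - 1) = 2 (b - a) - N\<close> times.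
\<close>

lemma bracket_defect_sum:
  fixes w :: "nat \<times> nat \<Rightarrow> int"
  shows "(\<Sum>i=1..N. \<Sum>j=1..N. \<Sum>k=1..N. if i < j \<and> j < k then w (i, k) - w (i, j) - w (j, k) else 0) =
    (\<Sum>p\<in>upper_positions N. (2 * height p - int N) * w p)" (is "?lhs = _")
proof -
  let ?t = "\<lambda>i j k x. if i < j \<and> j < k then x else (0 :: int)"
  have split: "?lhs = (\<Sum>i=1..N. \<Sum>j=1..N. \<Sum>k=1..N. ?t i j k (w (i, k)))
      - (\<Sum>i=1..N. \<Sum>j=1..N. \<Sum>k=1..N. ?t i j k (w (i, j)))
      - (\<Sum>i=1..N. \<Sum>j=1..N. \<Sum>k=1..N. ?t i j k (w (j, k)))"
    unfolding sum_subtractf[symmetric] by (intro sum.cong) auto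
  have count: "(\<Sum>x=1..N. if Q x then c else 0) = int (card {x \<in> {1..N}. Q x}) * c" for Q and c :: int
    by (subst sum.inter_filter[symmetric]) simp_all
  have mid: "(\<Sum>j=1..N. ?t i j k x) = (if i < k then (int k - int i - 1) * x else 0)"
    if "i \<in> {1..N}" "k \<in> {1..N}" for i k x
  proof -
    have "{j \<in> {1..N}. i < j \<and> j < k} = {i<..<k}" using that by auto
    then show ?thesis unfolding count by (simp add: of_nat_diff)
  qed
  have right: "(\<Sum>k=1..N. ?t i j k x) = (if i < j then (int N - int j) * x else 0)"
    if "j \<in> {1..N}" for i j x
  proof -
    have "{k \<in> {1..N}. i < j \<and> j < k} = (if i < j then {j<..N} else {})" using that by auto
    then show ?thesis unfolding count using that by (simp add: of_nat_diff)
  qed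
  have left: "(\<Sum>i=1..N. ?t i j k x) = (if j < k then (int j - 1) * x else 0)"
    if "j \<in> {1..N}" for j k x
  proof -
    have "{i \<in> {1..N}. i < j \<and> j < k} = (if j < k then {1..<j} else {})" using that by auto
    then show ?thesis unfolding count using that by (simp add: of_nat_diff)
  qed
  have 1: "(\<Sum>i=1..N. \<Sum>j=1..N. \<Sum>k=1..N. ?t i j k (w (i, k))) =
      (\<Sum>i=1..N. \<Sum>k=1..N. if i < k then (int k - int i - 1) * w (i, k) else 0)"
    by (subst sum.swap[of _ "{1..N}" "{1..N}"]) (intro sum.cong refl mid)
  have 2: "(\<Sum>i=1..N. \<Sum>j=1..N. \<Sum>k=1..N. ?t i j k (w (i, j))) =
      (\<Sum>i=1..N. \<Sum>j=1..N. if i < j then (int N - int j) * w (i, j) else 0)"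
    by (intro sum.cong refl right)
  have "(\<Sum>i=1..N. \<Sum>j=1..N. \<Sum>k=1..N. ?t i j k (w (j, k))) =
      (\<Sum>j=1..N. \<Sum>i=1..N. \<Sum>k=1..N. ?t i j k (w (j, k)))"
    by (rule sum.swap)
  also have "\<dots> = (\<Sum>j=1..N. \<Sum>k=1..N. \<Sum>i=1..N. ?t i j k (w (j, k)))"
    by (intro sum.cong refl sum.swap)
  also have "\<dots> = (\<Sum>j=1..N. \<Sum>k=1..N. if j < k then (int j - 1) * w (j, k) else 0)"
    by (intro sum.cong refl left)
  finally have 3: "(\<Sum>i=1..N. \<Sum>j=1..N. \<Sum>k=1..N. ?t i j k (w (j, k))) = \<dots>" .
  show ?thesis
    unfolding split 1 2 3 sum_upper_positions sum_subtractf[symmetric]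
    by (intro sum.cong refl) (auto simp: algebra_simps)
qed

lemma superadditive_weight_bound:
  fixes w :: "nat \<times> nat \<Rightarrow> int"
  assumes "\<And>i j k. (i, j) \<in> upper_positions N \<Longrightarrow> (j, k) \<in> upper_positions N \<Longrightarrow>
    w (i, j) + w (j, k) \<le> w (i, k)"
  shows "int N * (\<Sum>p\<in>upper_positions N. w p) \<le> 2 * (\<Sum>p\<in>upper_positions N. height p * w p)"
proof -
  have "0 \<le> (\<Sum>p\<in>upper_positions N. (2 * height p - int N) * w p)"
    unfolding bracket_defect_sum[symmetric]
    using assms by (intro sum_nonneg) (force simp: upper_positions_def)
  then show ?thesis
    by (simp add: left_diff_distrib sum_subtractf sum_distrib_left mult.assoc)
qed

text \<open>
  The height is additive, so each bracket defect vanishes and the bound above is an equality.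
\<close>

lemma sum_height_squared:
  "int N * (\<Sum>p\<in>upper_positions N. height p) = 2 * (\<Sum>p\<in>upper_positions N. (height p)\<^sup>2)"
proof -
  have "(\<Sum>p\<in>upper_positions N. (2 * height p - int N) * height p) = 0"
    unfolding bracket_defect_sum[symmetric] by (intro sum.neutral ballI) auto
  then show ?thesis
    by (simp add: left_diff_distrib sum_subtractf sum_distrib_left mult.assoc power2_eq_square)
qed

text \<open>
  This identity contains the Cauchy-Schwarz inequality together with its equality case, without
  leaving the integers.
\<close>

lemma Lagrange_identity_sum:
  fixes u w :: "'a \<Rightarrow> int" and S :: "'a set"
  defines "T \<equiv> \<Sum>p\<in>S. (u p)\<^sup>2" and "I \<equiv> \<Sum>p\<in>S. u p * w p"
  shows "(\<Sum>p\<in>S. (T * w p - I * u p)\<^sup>2) = T * (T * (\<Sum>p\<in>S. (w p)\<^sup>2) - I\<^sup>2)"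
proof -
  have "(\<Sum>p\<in>S. (T * w p - I * u p)\<^sup>2) =
      (\<Sum>p\<in>S. T\<^sup>2 * (w p)\<^sup>2 - 2 * T * I * (u p * w p) + I\<^sup>2 * (u p)\<^sup>2)"
    by (intro sum.cong) (auto simp: power2_eq_square algebra_simps)
  also have "\<dots> = T\<^sup>2 * (\<Sum>p\<in>S. (w p)\<^sup>2) - 2 * T * I * I + I\<^sup>2 * T"
    unfolding sum.distrib sum_subtractf sum_distrib_left[symmetric] by (simp only: T_def I_def)
  finally show ?thesis by (simp add: power2_eq_square algebra_simps)
qed

text \<open>
  With \<open>t\<close> and \<open>q\<close> the norms of the height filtration and of \<open>F\<close>, and \<open>I\<close> the inner product of
  \<open>w\<close> with the height, \<open>N * wt F \<le> 2 * I \<le> 2 * t * q\<close>, while the height filtration itself has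
  \<open>wt / norm = 2 * t / N\<close>. If \<open>nu F\<close> attains the minimum, both estimates are equalities.
\<close>

lemma nu_height_filtration_le:
  fixes F :: "int \<Rightarrow> 'k :: field_char_0 matrix set"
  assumes N: "N \<ge> 2" and F: "nilradical.filtration N F" and w: "weight_function N F w"
  shows "nilradical.nu (height_filtration N :: int \<Rightarrow> 'k matrix set) < 0"
    and "nilradical.nu (height_filtration N :: int \<Rightarrow> 'k matrix set) \<le> nilradical.nu F"
    and "nilradical.nu F \<le> nilradical.nu (height_filtration N :: int \<Rightarrow> 'k matrix set) \<Longrightarrow>
      \<exists>c > 0. \<forall>p\<in>upper_positions N. w p = c * height p"
proof -
  let ?H = "height_filtration N :: int \<Rightarrow> 'k matrix set"
  define S where "S = (\<Sum>p\<in>upper_positions N. height p)"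
  define T where "T = (\<Sum>p\<in>upper_positions N. (height p)\<^sup>2)"
  define a where "a = (\<Sum>p\<in>upper_positions N. w p)"
  define Q where "Q = (\<Sum>p\<in>upper_positions N. (w p)\<^sup>2)"
  define I where "I = (\<Sum>p\<in>upper_positions N. height p * w p)"
  note H = filtration_height_filtration[of N, where 'k = 'k]
    weight_function_height_filtration[of N, where 'k = 'k]
  have nuH: "nilradical.nu ?H = - (real_of_int S / sqrt (real_of_int T))"
    using sum_over_weights[OF H, of "\<lambda>m. m"] sum_over_weights[OF H, of "\<lambda>m. m\<^sup>2"]
    by (simp add: nilradical.nu_def nilradical.wt_def nilradical.filtration_norm_def S_def T_def)
  have nuF: "nilradical.nu F = - (real_of_int a / sqrt (real_of_int Q))"
    using sum_over_weights[OF F w, of "\<lambda>m. m"] sum_over_weights[OF F w, of "\<lambda>m. m\<^sup>2"]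
    by (simp add: nilradical.nu_def nilradical.wt_def nilradical.filtration_norm_def a_def Q_def)
  \<comment> \<open>A position of height one exists; the weight there will be the integral factor \<open>c\<close>.\<close>
  have p12: "(1, 2) \<in> upper_positions N" using N by (simp add: upper_positions_def)
  have S: "S > 0" unfolding S_def
    using p12 height_bounds by (intro sum_pos) force+
  have NS: "int N * S = 2 * T" using sum_height_squared[of N] by (simp add: S_def T_def)
  have T: "T > 0"
  proof -
    have "0 < int N * S" using S N by simp
    then show ?thesis using NS by linarith
  qed
  have Na: "int N * a \<le> 2 * I" unfolding a_def I_def
    using weight_function_superadditive[OF F w] by (rule superadditive_weight_bound)
  have lagrange: "(\<Sum>p\<in>upper_positions N. (T * w p - I * height p)\<^sup>2) = T * (T * Q - I\<^sup>2)"
    using Lagrange_identity_sum[of height "upper_positions N" w] by (simp add: T_def Q_def I_def)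
  have "0 \<le> T * (T * Q - I\<^sup>2)"
    unfolding lagrange[symmetric] by (intro sum_nonneg) simp
  then have CS: "I\<^sup>2 \<le> T * Q" using T by (simp add: zero_le_mult_iff)
  have Q0: "Q \<ge> 0" unfolding Q_def by (intro sum_nonneg) simp
  define t q where "t = sqrt (real_of_int T)" and "q = sqrt (real_of_int Q)"
  have t: "t > 0" "t * t = real_of_int T" and q: "q \<ge> 0" "q * q = real_of_int Q"
    using T Q0 by (simp_all add: t_def q_def)
  have St: "real_of_int S / t = 2 * t / real N"
  proof -
    have "real_of_int (int N * S) = real_of_int (2 * T)" by (simp only: NS)
    then have "real N * real_of_int S = 2 * (t * t)" unfolding t(2) by simp
    then show ?thesis using t N by (simp add: field_simps)
  qed
  have "sqrt (real_of_int (I\<^sup>2)) \<le> sqrt (real_of_int (T * Q))"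
    using CS by (intro real_sqrt_le_mono) (simp only: of_int_le_iff)
  then have Itq: "real_of_int I \<le> t * q"
    by (simp add: t_def q_def real_sqrt_mult)
  have "real_of_int (int N * a) \<le> real_of_int (2 * I)" using Na by (simp only: of_int_le_iff)
  then have Na': "real N * real_of_int a \<le> 2 * real_of_int I" by simp
  show neg: "nilradical.nu ?H < 0"
    using nuH S T by simp
  show "nilradical.nu ?H \<le> nilradical.nu F"
  proof (cases "q = 0")
    \<comment> \<open>Division by zero gives \<open>nu F = 0\<close>.\<close>
    case True
    then show ?thesis using neg by (simp add: nuF q_def)
  next
    case False
    then have "real_of_int a / q \<le> 2 * t / real N"
      using Na' Itq q N by (simp add: field_simps)
    then show ?thesis unfolding nuF nuH t_def[symmetric] q_def[symmetric] St by simp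
  qed
  show "\<exists>c > 0. \<forall>p\<in>upper_positions N. w p = c * height p"
    if le: "nilradical.nu F \<le> nilradical.nu ?H"
  proof -
    have "q \<noteq> 0" using le neg by (auto simp: nuF q_def)
    then have qpos: "q > 0" using q by simp
    have "2 * t / real N \<le> real_of_int a / q"
      using le unfolding nuF nuH t_def[symmetric] q_def[symmetric] St by simp
    then have "2 * t * q \<le> real N * real_of_int a"
      using qpos N by (simp add: field_simps)
    then have tqI: "t * q \<le> real_of_int I" using Na' by simp
    moreover have "0 < t * q" using t qpos by simp
    ultimately have "0 < real_of_int I" by linarith
    then have I: "I > 0" by simp
    have "(t * q)\<^sup>2 \<le> (real_of_int I)\<^sup>2"
      using tqI t qpos by (intro power_mono) auto
    moreover have "(t * q)\<^sup>2 = real_of_int (T * Q)"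
      unfolding of_int_mult t(2)[symmetric] q(2)[symmetric] by (simp add: power2_eq_square)
    ultimately have "real_of_int (T * Q) \<le> real_of_int (I\<^sup>2)" by simp
    then have "T * Q \<le> I\<^sup>2" by (simp only: of_int_le_iff)
    then have "T * Q = I\<^sup>2" using CS by linarith
    then have "(\<Sum>p\<in>upper_positions N. (T * w p - I * height p)\<^sup>2) = 0"
      using lagrange by simp
    then have proportional: "T * w p = I * height p" if "p \<in> upper_positions N" for p
      using that by (subst (asm) sum_nonneg_eq_0_iff) auto
    have c: "T * w (1, 2) = I" using proportional[OF p12] by simp
    have "w p = w (1, 2) * height p" if "p \<in> upper_positions N" for p
    proof -
      have "T * w p = T * (w (1, 2) * height p)"
        by (simp only: proportional[OF that] c[symmetric] mult.assoc)
      then show ?thesis using T by simp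
    qed
    moreover have "w (1, 2) > 0" using zero_less_mult_pos[of T "w (1, 2)"] c I T by simp
    ultimately show ?thesis by blast
  qed
qed

text \<open>
  The leading position of a matrix has minimal height among its nonzero entries. If the leading
  positions of \<open>F m\<close> are all those of height at least \<open>d\<close>, then \<open>F m\<close> is contained in the \<open>d\<close>-th
  step of the height filtration, and both have the same leading positions.
\<close>

lemma eq_rescale_height_filtration:
  fixes F :: "int \<Rightarrow> 'k :: field_char_0 matrix set"
  assumes F: "nilradical.filtration N F" and w: "weight_function N F w"
    and c: "c > 0" and wc: "\<forall>p\<in>upper_positions N. w p = int c * height p"
  shows "F = rescale_filtration c (height_filtration N)"
proof
  fix m
  let ?d = "\<lceil>real_of_int m / real c\<rceil>"
  let ?H = "height_filtration N ?d :: 'k matrix set"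
  note H = filtration_height_filtration[of N, where 'k = 'k]
    weight_function_height_filtration[of N, where 'k = 'k]
  have d: "m \<le> int c * h \<longleftrightarrow> ?d \<le> h" for h
  proof -
    have "?d \<le> h \<longleftrightarrow> real_of_int m \<le> real_of_int (int c * h)"
      using c by (simp add: ceiling_le_iff field_simps)
    then show ?thesis by linarith
  qed
  have L: "leading_positions N (F m) = leading_positions N ?H"
    unfolding leading_positions_weight_function[OF w] leading_positions_weight_function[OF H(2)]
    using wc d by auto
  have "F m \<subseteq> ?H"
  proof
    fix X assume X: "X \<in> F m"
    then have XN: "X \<in> nilradical N" using filtrationD(2)[OF F] by blast
    have "?d \<le> height (i, j)" if nz: "X i j \<noteq> 0" for i j
    proof -
      have "X \<noteq> 0" using nz by auto
      then obtain p where p: "leads_at N X p" using leads_at_exists[OF XN] by blast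
      then have pN: "p \<in> upper_positions N" and pd: "deg N p \<le> deg N (i, j)"
        using nz unfolding leads_at_def by blast+
      have "p \<in> leading_positions N ?H"
        using p X L by (auto simp: leading_positions_def)
      then have "?d \<le> height p"
        using leading_positions_weight_function[OF H(2)] by blast
      also have "\<dots> \<le> height (i, j)"
        using deg_less_if_height_less[OF nilradical_entry[OF XN nz] pN] pd by linarith
      finally show ?thesis .
    qed
    then show "X \<in> ?H" using XN by (simp add: height_filtration_eq)
  qed
  then have "F m = ?H"
    using L filtrationD[OF F] filtrationD[OF H(1)]
    by (intro subspace_eq_if_leading_positions_eq[of _ _ N]) auto
  then show "F m = rescale_filtration c (height_filtration N) m"
    by (simp add: rescale_filtration_def)
qed

theorem proposition6p12:
  fixes n :: nat
  assumes "n \<ge> 1"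
  shows "nilradical.canonical_filtration (n + 1)
      (height_filtration (n + 1) :: int \<Rightarrow> 'k :: {alg_closed_field, field_char_0} matrix set) \<and>
    (\<forall>F :: int \<Rightarrow> 'k matrix set. nilradical.canonical_filtration (n + 1) F \<longrightarrow>
       eq_up_to_rescaling F (height_filtration (n + 1)))"
proof -
  define N where "N = n + 1"
  have N: "N \<ge> 2" using assms by (simp add: N_def)
  let ?H = "height_filtration N :: int \<Rightarrow> 'k matrix set"
  note H = filtration_height_filtration[of N, where 'k = 'k]
    weight_function_height_filtration[of N, where 'k = 'k]
  have neg: "nilradical.nu ?H < 0" by (rule nu_height_filtration_le(1)[OF N H])
  have "\<not> - nilradical.wt ?H \<ge> 0"
  proof
    assume "- nilradical.wt ?H \<ge> 0"
    moreover have "nilradical.filtration_norm ?H \<ge> 0"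
      by (simp add: nilradical.filtration_norm_def sum_nonneg)
    ultimately have "nilradical.nu ?H \<ge> 0"
      unfolding nilradical.nu_def by (intro divide_nonneg_nonneg) auto
    then show False using neg by simp
  qed
  then have unstable: "\<not> (\<forall>F :: int \<Rightarrow> 'k matrix set. nilradical.filtration N F \<longrightarrow> - nilradical.wt F \<ge> 0)"
    using H(1) by blast
  have canonical_iff: "nilradical.canonical_filtration N F \<longleftrightarrow>
      nilradical.filtration N F \<and> F \<noteq> nilradical.trivial_filtration N \<and>
        (\<forall>G :: int \<Rightarrow> 'k matrix set. nilradical.filtration N G \<longrightarrow> G \<noteq> nilradical.trivial_filtration N \<longrightarrow>
          nilradical.nu F \<le> nilradical.nu G)" for F :: "int \<Rightarrow> 'k matrix set"
    unfolding nilradical.canonical_filtration_def nilradical.semistable_def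
    by (simp only: unstable if_False)
  have p12: "(1, 2) \<in> upper_positions N" using N by (simp add: upper_positions_def)
  have "?H \<noteq> nilradical.trivial_filtration N"
  proof
    assume "?H = nilradical.trivial_filtration N"
    then have "?H 1 = {0}" by (simp add: nilradical.trivial_filtration_def)
    moreover have "(1, 2) \<in> leading_positions N (?H 1)"
      using H(2) p12 by (simp add: weight_function_def)
    ultimately show False by (simp add: leading_positions_def leads_at_def)
  qed
  then have can: "nilradical.canonical_filtration N ?H"
    unfolding canonical_iff using H(1) nu_height_filtration_le(2)[OF N] weight_function_exists by blast
  have "eq_up_to_rescaling F ?H" if F: "nilradical.canonical_filtration N F"
    for F :: "int \<Rightarrow> 'k matrix set"
  proof -
    have filt: "nilradical.filtration N F" and "nilradical.nu F \<le> nilradical.nu ?H"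
      using F can unfolding canonical_iff by auto
    moreover obtain w where w: "weight_function N F w" using weight_function_exists[OF filt] ..
    ultimately obtain c where c: "c > 0" "\<forall>p\<in>upper_positions N. w p = c * height p"
      using nu_height_filtration_le(3)[OF N] by blast
    then have "F = rescale_filtration (nat c) ?H"
      by (intro eq_rescale_height_filtration[OF filt w]) auto
    moreover have "rescale_filtration 1 F = F"
      by (simp add: rescale_filtration_def fun_eq_iff)
    ultimately show ?thesis
      unfolding eq_up_to_rescaling_def using c(1)
      by (intro exI[of _ 1] exI[of _ "nat c"]) auto
  qed
  then show ?thesis using can by (simp add: N_def)
qed

end
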